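(* Let $p$ be a prime and let $k,t$ be integers with $k\ge2$ and $2\le t<\frac{\sqrt p}{4}$. Define $\ell$ and $M$ as follows: if $k=2$, let $M=\ell=1$; if $k\ge3$, let $\ell=\lfloor\log_p k\rfloor+2$ and $M=\lfloor (k-1)/\ell\rfloor$. Let $t'=t+M-1$. Then there exists a set $S\subseteq(\mathbb{Z}/p^k\mathbb{Z})^2$ of size $$|S|=2^M\binom{t+1}{2}+2^M-1$$ such that $S$ cannot be covered by $t'$ lines, but for every $x\in S$ the set $S\setminus\{x\}$ can be covered by $t'$ lines.
   Context: Write $\mathcal{R}=\mathbb{Z}/p^k\mathbb{Z}$. A line in $\mathcal{R}^2$ is a set of the form $L_b(a)=\{a+sb: s\in\mathcal{R}\}$, where $a\in\mathcal{R}^2$ and $b=(b_1,b_2)\in\mathcal{R}^2$ has at least one coordinate that is invertible in $\mathcal{R}$. A set is covered by $t'$ lines if it is contained in the union of some $t'$ lines. *)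

theory Defs
  imports Complex_Main "HOL-Number_Theory.Residues"
begin

definition plane :: "('a, 'm) ring_scheme \<Rightarrow> ('a \<times> 'a) set"
  where "plane R = carrier R \<times> carrier R"

definition line :: "('a, 'm) ring_scheme \<Rightarrow> 'a \<times> 'a \<Rightarrow> 'a \<times> 'a \<Rightarrow> ('a \<times> 'a) set"
  where "line R b a =
    {(fst a \<oplus>\<^bsub>R\<^esub> s \<otimes>\<^bsub>R\<^esub> fst b, snd a \<oplus>\<^bsub>R\<^esub> s \<otimes>\<^bsub>R\<^esub> snd b) | s. s \<in> carrier R}"

definition is_line :: "('a, 'm) ring_scheme \<Rightarrow> ('a \<times> 'a) set \<Rightarrow> bool"
  where "is_line R A \<longleftrightarrow>
    (\<exists>a \<in> plane R. \<exists>b \<in> plane R. (fst b \<in> Units R \<or> snd b \<in> Units R) \<and> A = line R b a)"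

(* The n lines need not be distinct. *)
definition covered_by_lines ::
    "('a, 'm) ring_scheme \<Rightarrow> nat \<Rightarrow> ('a \<times> 'a) set \<Rightarrow> bool"
  where "covered_by_lines R n A \<longleftrightarrow>
    (\<exists>L :: nat \<Rightarrow> ('a \<times> 'a) set. (\<forall>i<n. is_line R (L i)) \<and> A \<subseteq> (\<Union>i<n. L i))"

end

theory Submission
  imports Defs
begin

text \<open>Work with integer points and lines modulo powers of p. A triangular grid with t points on
  each side is critical for t - 1 lines. If S is critical modulo \<open>p ^ a\<close> for n lines, replace
  every point (x, y) by the twins \<open>(x, p ^ c * y)\<close> and \<open>(x + p ^ a, p ^ c * y)\<close> and add one point
  \<open>q = (u, p ^ (c - 1))\<close>; the result is critical modulo \<open>p ^ (a + c)\<close> for n + 1 lines. Indeed the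
  line \<open>y = m * x + d\<close> lifts to \<open>y = p ^ c * (m * x + d)\<close>, which contains both twins of each of its
  points, so after deleting one twin n lifted lines cover all twins but one, and this one is joined
  to q by a line. Conversely, a line through q never contains both twins of a point, so it leaves a
  copy of S, on which every other line traces a line modulo \<open>p ^ a\<close>. The line joining q to a twin
  must again be non-vertical, for which u must avoid the first coordinates modulo \<open>p ^ c\<close>.\<close>

section \<open>Coverings, critical sets and lines as sets of integer points\<close>

definition coverable :: "('a set \<Rightarrow> bool) \<Rightarrow> nat \<Rightarrow> 'a set \<Rightarrow> bool"
  where "coverable P n S \<longleftrightarrow>
    (\<exists>F. finite F \<and> card F \<le> n \<and> (\<forall>L\<in>F. P L) \<and> S \<subseteq> \<Union>F)"

text \<open>Coverings use only a subfamily Q of the lines in P: the lift in the doubling step exists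
  for non-vertical lines only.\<close>

definition critical :: "('a set \<Rightarrow> bool) \<Rightarrow> ('a set \<Rightarrow> bool) \<Rightarrow> nat \<Rightarrow> 'a set \<Rightarrow> bool"
  where "critical P Q n S \<longleftrightarrow> \<not> coverable P n S \<and> (\<forall>z\<in>S. coverable Q n (S - {z}))"

text \<open>Every such set is a union of residue classes modulo \<open>p ^ a\<close>, so the modulus
  can change from step to step while all points stay in the integer plane. For prime
  \<open>p\<close> and \<open>a >= 1\<close>, the condition on \<open>A\<close> and \<open>B\<close>
  says that one of them is a unit modulo \<open>p ^ a\<close>.\<close>

definition zline :: "int \<Rightarrow> nat \<Rightarrow> (int \<times> int) set \<Rightarrow> bool"
  where "zline p a L \<longleftrightarrow> (\<exists>A B C. (\<not> p dvd A \<or> \<not> p dvd B) \<and>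
    L = {(x, y). p ^ a dvd A * x + B * y - C})"

definition zgraph :: "int \<Rightarrow> nat \<Rightarrow> (int \<times> int) set \<Rightarrow> bool"
  where "zgraph p a L \<longleftrightarrow> (\<exists>m c. L = {(x, y). p ^ a dvd y - m * x - c})"

lemma zgraph_imp_zline:
  assumes "\<not> is_unit p" "zgraph p a L"
  shows "zline p a L"
proof -
  obtain m c where "L = {(x, y). p ^ a dvd y - m * x - c}"
    using assms(2) by (auto simp: zgraph_def)
  then have "L = {(x, y). p ^ a dvd (- m) * x + 1 * y - c}"
    by (simp add: algebra_simps)
  then show ?thesis
    unfolding zline_def using assms(1) by blast
qed

lemma coverable_subset:
  assumes "coverable P n T" "S \<subseteq> T"
  shows "coverable P n S"
  using assms unfolding coverable_def by blast

lemma coverable_0: "coverable P 0 S \<Longrightarrow> S = {}"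
  by (auto simp: coverable_def)

lemma coverable_insert:
  assumes "coverable P n S" "P L"
  shows "coverable P (Suc n) (S \<union> L)"
proof -
  obtain F where F: "finite F" "card F \<le> n" "\<forall>L\<in>F. P L" "S \<subseteq> \<Union>F"
    using assms(1) unfolding coverable_def by blast
  have "card (insert L F) \<le> Suc n"
    using F(1,2) by (simp add: card_insert_if)
  then show ?thesis
    unfolding coverable_def using F assms(2)
    by (intro exI[of _ "insert L F"]) auto
qed

text \<open>Pulls a cover back along \<open>h\<close>: lines are replaced one for one, so their
  number does not grow even if replacements coincide.\<close>

lemma coverable_transfer:
  assumes "coverable P n S"
    and "\<And>L. P L \<Longrightarrow> \<exists>L'. Q L' \<and> (\<forall>z\<in>L. \<forall>w\<in>T. h w = z \<longrightarrow> w \<in> L')"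
    and "h ` T \<subseteq> S"
  shows "coverable Q n T"
proof -
  obtain F where F: "finite F" "card F \<le> n" "\<forall>L\<in>F. P L" "S \<subseteq> \<Union>F"
    using assms(1) unfolding coverable_def by blast
  obtain g where g: "\<And>L. P L \<Longrightarrow> Q (g L) \<and> (\<forall>z\<in>L. \<forall>w\<in>T. h w = z \<longrightarrow> w \<in> g L)"
    using assms(2) by metis
  have "T \<subseteq> \<Union>(g ` F)"
  proof
    fix w assume "w \<in> T"
    then obtain L where "L \<in> F" "h w \<in> L" using assms(3) F(4) by blast
    then show "w \<in> \<Union>(g ` F)" using g F(3) \<open>w \<in> T\<close> by blast
  qed
  moreover have "card (g ` F) \<le> n"
    using F(1,2) card_image_le le_trans by blast
  ultimately show ?thesis
    unfolding coverable_def using F g by (intro exI[of _ "g ` F"]) auto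
qed

text \<open>If no line of the family Q separates two points of S, then any cover of S without one of
  them covers S.\<close>

lemma critical_inj_on:
  assumes "critical P Q n S"
    and "\<And>L. Q L \<Longrightarrow> P L"
    and "\<And>L z w. Q L \<Longrightarrow> h z = h w \<Longrightarrow> z \<in> L \<Longrightarrow> w \<in> L"
  shows "inj_on h S"
proof (rule inj_onI, rule ccontr)
  fix z w assume zw: "z \<in> S" "w \<in> S" "h z = h w" "z \<noteq> w"
  obtain F where F: "finite F" "card F \<le> n" "\<forall>L\<in>F. Q L" "S - {w} \<subseteq> \<Union>F"
    using assms(1) zw unfolding critical_def coverable_def by meson
  obtain L where "L \<in> F" "z \<in> L" using F zw by blast
  then have "w \<in> L" using assms(3) F zw by blast
  then have "S \<subseteq> \<Union>F" using F \<open>L \<in> F\<close> by blast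
  then have "coverable P n S" unfolding coverable_def using F assms(2) by blast
  then show False using assms(1) by (simp add: critical_def)
qed

subsection \<open>The doubling step\<close>

definition doubling :: "int \<Rightarrow> nat \<Rightarrow> nat \<Rightarrow> int \<Rightarrow> (int \<times> int) set \<Rightarrow> (int \<times> int) set"
  where "doubling p a c u S =
    insert (u, p ^ (c - 1))
      ((\<lambda>(x, y). (x, p ^ c * y)) ` S \<union> (\<lambda>(x, y). (x + p ^ a, p ^ c * y)) ` S)"

text \<open>The exponent \<open>j\<close> is the \<open>p\<close>-adic valuation of \<open>A\<close>
  cut off at \<open>c\<close>; the cutoff also admits \<open>A = 0\<close>.\<close>

lemma prime_power_part:
  fixes A p :: int
  assumes "prime p"
  obtains j v where "j \<le> c" "A = p ^ j * v" "j = c \<or> \<not> p dvd v"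
proof -
  have "\<exists>j v. j \<le> c \<and> A = p ^ j * v \<and> (j = c \<or> \<not> p dvd v)"
  proof (induction c)
    case 0
    then show ?case by simp
  next
    case (Suc c)
    then obtain j v where jv: "j \<le> c" "A = p ^ j * v" "j = c \<or> \<not> p dvd v" by blast
    show ?case
    proof (cases "p dvd v")
      case True
      then obtain w where "v = p * w" by blast
      then have "A = p ^ Suc c * w" using jv True by simp
      then show ?thesis by blast
    next
      case False
      then show ?thesis using jv le_SucI by blast
    qed
  qed
  then show ?thesis using that by blast
qed

text \<open>On points with second coordinate \<open>p ^ c * y\<close> the coefficients become
  \<open>A\<close> and \<open>B * p ^ c\<close>, with common factor \<open>p ^ j\<close>, where
  \<open>j\<close> is the valuation of \<open>A\<close> cut off at \<open>c\<close>. Dividing by it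
  leaves a modulus that is still a multiple of \<open>p ^ a\<close>, for which the shift by
  \<open>p ^ a\<close> is invisible. If \<open>p\<close> still divides \<open>v\<close>, then
  \<open>j = c\<close> and \<open>p\<close> divides \<open>A\<close>, so \<open>B' = B\<close> is
  prime to \<open>p\<close>.\<close>

lemma zline_trace:
  assumes p: "prime (p::int)" and c: "c \<ge> 1" and L: "zline p (a + c) L"
  shows "\<exists>L'. zline p a L' \<and>
    (\<forall>x y. (x, p ^ c * y) \<in> L \<or> (x + p ^ a, p ^ c * y) \<in> L \<longrightarrow> (x, y) \<in> L')"
proof -
  obtain A B C where ABC: "\<not> p dvd A \<or> \<not> p dvd B"
    and L: "L = {(x, y). p ^ (a + c) dvd A * x + B * y - C}"
    using L unfolding zline_def by blast
  obtain j v where jv: "j \<le> c" "A = p ^ j * v" "j = c \<or> \<not> p dvd v"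
    using prime_power_part[OF p] by blast
  define B' where "B' = B * p ^ (c - j)"
  have pc: "p ^ c = p ^ j * p ^ (c - j)" using jv(1) by (simp flip: power_add)
  have pac: "p ^ (a + c) = p ^ j * (p ^ a * p ^ (c - j))" by (simp add: power_add pc)
  have cop: "\<not> p dvd v \<or> \<not> p dvd B'"
  proof (cases "p dvd v")
    case True
    then have "j = c" using jv by blast
    then have "p dvd A" using jv c by (simp add: dvd_power)
    then show ?thesis using ABC \<open>j = c\<close> by (simp add: B'_def)
  qed simp
  have p0: "p ^ j \<noteq> 0" using p by auto
  show ?thesis
  proof (cases "p ^ j dvd C")
    case True
    then obtain D where D: "C = p ^ j * D" by blast
    have step: "p ^ a dvd v * x + B' * y - D" if "p ^ (a + c) dvd A * x + B * (p ^ c * y) - C" for x y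
    proof -
      have "A * x + B * (p ^ c * y) - C = p ^ j * (v * x + B' * y - D)"
        by (simp add: jv(2) D pc B'_def algebra_simps)
      then have "p ^ j * (p ^ a * p ^ (c - j)) dvd p ^ j * (v * x + B' * y - D)"
        using that by (simp only: pac)
      then have "p ^ a * p ^ (c - j) dvd v * x + B' * y - D"
        using p0 by (simp only: dvd_mult_cancel_left) blast
      then show ?thesis using dvd_mult_left by blast
    qed
    have "p ^ a dvd v * x + B' * y - D" if "p ^ (a + c) dvd A * (x + p ^ a) + B * (p ^ c * y) - C" for x y
    proof -
      have "p ^ a dvd v * (x + p ^ a) + B' * y - D - v * p ^ a"
        using step[OF that] by (rule dvd_diff) simp
      then show ?thesis by (simp add: algebra_simps)
    qed
    then show ?thesis
      using step cop
      by (intro exI[of _ "{(x, y). p ^ a dvd v * x + B' * y - D}"])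
        (auto simp: zline_def L)
  next
    case False
    \<comment> \<open>The trace is empty in this case, so any line serves; \<open>x = 0\<close> is
      taken.\<close>
    have "p ^ j dvd C" if "p ^ (a + c) dvd A * x + B * (p ^ c * y) - C" for x y
    proof -
      have "p ^ j dvd A * x + B * (p ^ c * y) - C" using that pac dvd_mult_left by metis
      then have "p ^ j dvd (A * x + B * (p ^ c * y)) - (A * x + B * (p ^ c * y) - C)"
        by (rule dvd_diff[rotated]) (simp add: jv(2) pc)
      then show ?thesis by simp
    qed
    then have "(x, p ^ c * y) \<notin> L" for x y using False by (auto simp: L)
    moreover have "\<not> p dvd 1" using p not_prime_unit by blast
    then have "zline p a {(x, y). p ^ a dvd 1 * x + 0 * y - 0}"
      unfolding zline_def by blast
    ultimately show ?thesis by blast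
  qed
qed

text \<open>Subtracting the equations of two twins gives \<open>p ^ c dvd A\<close>, so
  \<open>B\<close> is prime to \<open>p\<close>. Modulo \<open>p ^ c\<close> the line then reads
  \<open>B * y = C\<close>: a twin forces \<open>C\<close> to vanish there, while the added point
  gives \<open>B * p ^ (c - 1)\<close>, which does not vanish.\<close>

lemma zline_separates_twins:
  assumes p: "prime (p::int)" and c: "c \<ge> 1" and L: "zline p (a + c) L"
    and u: "(u, p ^ (c - 1)) \<in> L" and x: "(x, p ^ c * y) \<in> L"
  shows "(x + p ^ a, p ^ c * y) \<notin> L"
proof
  assume x': "(x + p ^ a, p ^ c * y) \<in> L"
  obtain A B C where ABC: "\<not> p dvd A \<or> \<not> p dvd B"
    and L: "L = {(x, y). p ^ (a + c) dvd A * x + B * y - C}"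
    using L unfolding zline_def by blast
  have p0: "p \<noteq> 0" using p by auto
  have du: "p ^ (a + c) dvd A * u + B * p ^ (c - 1) - C"
    and dx: "p ^ (a + c) dvd A * x + B * (p ^ c * y) - C"
    and dx': "p ^ (a + c) dvd A * (x + p ^ a) + B * (p ^ c * y) - C"
    using u x x' unfolding L by auto
  have "p ^ (a + c) dvd (A * (x + p ^ a) + B * (p ^ c * y) - C) - (A * x + B * (p ^ c * y) - C)"
    by (rule dvd_diff[OF dx' dx])
  then have "p ^ a * p ^ c dvd p ^ a * A" by (simp add: algebra_simps power_add)
  then have A: "p ^ c dvd A" using p0 by simp
  then have "p dvd A" using c by (meson dvd_power dvd_trans order_less_le_trans zero_less_one)
  then have B: "\<not> p dvd B" using ABC by blast
  have pc: "p ^ c = p ^ (c - 1) * p" using c by (cases c) auto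
  have "p ^ (a + c) dvd (A * u + B * p ^ (c - 1) - C) - (A * x + B * (p ^ c * y) - C)"
    by (rule dvd_diff[OF du dx])
  then have "p ^ c dvd (A * u + B * p ^ (c - 1) - C) - (A * x + B * (p ^ c * y) - C)"
    unfolding power_add by (rule dvd_mult_right)
  moreover have "p ^ c dvd A * (x - u) + p ^ c * (B * y)" using A by simp
  ultimately have "p ^ c dvd ((A * u + B * p ^ (c - 1) - C) - (A * x + B * (p ^ c * y) - C))
      + (A * (x - u) + p ^ c * (B * y))" by (rule dvd_add)
  then have "p ^ c dvd p ^ (c - 1) * B" by (simp add: algebra_simps)
  then show False using B p0 by (simp add: pc)
qed

lemma not_coverable_doubling:
  assumes p: "prime (p::int)" and c: "c \<ge> 1"
    and S: "\<not> coverable (zline p a) n S"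
  shows "\<not> coverable (zline p (a + c)) (Suc n) (doubling p a c u S)"
proof
  assume "coverable (zline p (a + c)) (Suc n) (doubling p a c u S)"
  then obtain F where F: "finite F" "card F \<le> Suc n" "\<forall>L\<in>F. zline p (a + c) L"
    and sub: "doubling p a c u S \<subseteq> \<Union>F"
    unfolding coverable_def by blast
  obtain L0 where L0: "L0 \<in> F" "(u, p ^ (c - 1)) \<in> L0"
    using sub unfolding doubling_def by blast
  define T where "T = doubling p a c u S - L0"
  have "coverable (zline p (a + c)) n T"
    unfolding coverable_def T_def
    using F sub L0 by (intro exI[of _ "F - {L0}"]) auto
  \<comment> \<open>\<open>L0\<close> misses at least one twin of every point; \<open>h\<close>
    selects such a twin.\<close>
  define h where "h = (\<lambda>(x, y). if (x, p ^ c * y) \<in> L0 then (x + p ^ a, p ^ c * y) else (x, p ^ c * y))"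
  have "coverable (zline p a) n S"
  proof (rule coverable_transfer[OF \<open>coverable (zline p (a + c)) n T\<close>])
    fix L assume "zline p (a + c) L"
    from zline_trace[OF p c this] obtain L' where L': "zline p a L'"
      "\<And>x y. (x, p ^ c * y) \<in> L \<or> (x + p ^ a, p ^ c * y) \<in> L \<Longrightarrow> (x, y) \<in> L'" by blast
    have "\<forall>z\<in>L. \<forall>w\<in>S. h w = z \<longrightarrow> w \<in> L'"
      using L'(2) by (auto simp: h_def split: if_splits)
    with L'(1) show "\<exists>L'. zline p a L' \<and> (\<forall>z\<in>L. \<forall>w\<in>S. h w = z \<longrightarrow> w \<in> L')" by blast
  next
    have "h (x, y) \<in> T" if "(x, y) \<in> S" for x y
    proof -
      have "(x, p ^ c * y) \<in> doubling p a c u S" "(x + p ^ a, p ^ c * y) \<in> doubling p a c u S"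
        using that unfolding doubling_def by force+
      then show ?thesis
        using zline_separates_twins[OF p c _ L0(2), of a x y] F(3) L0(1)
        by (auto simp: h_def T_def)
    qed
    then show "h ` S \<subseteq> T" by auto
  qed
  with S show False ..
qed

lemma coprime_inverse_mod:
  fixes w p :: int
  assumes "prime p" "\<not> p dvd w"
  obtains w' where "p ^ a dvd w * w' - 1"
proof -
  have "coprime w (p ^ a)"
    using assms by (simp add: prime_imp_coprime coprime_commute)
  then obtain w' where "[w * w' = 1] (mod p ^ a)"
    using cong_solve_coprime_int by blast
  then show ?thesis using that by (simp add: cong_iff_dvd_diff)
qed

text \<open>The slope should be \<open>(p ^ c * y - p ^ (c - 1)) / (x - u)\<close>. By the
  hypothesis on \<open>u\<close> the denominator has valuation \<open>j < c\<close>, so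
  \<open>p ^ j\<close> cancels against \<open>p ^ (c - 1)\<close>, and the remaining factor
  \<open>v\<close> is invertible modulo \<open>p ^ a\<close>. The exponents \<open>a\<close> and
  \<open>c\<close> are independent; the doubling step applies this with \<open>a + c\<close> for
  \<open>a\<close>.\<close>

lemma zgraph_through_two_points:
  assumes p: "prime (p::int)" and c: "c \<ge> 1" and u: "\<not> p ^ c dvd x - u"
  shows "\<exists>L. zgraph p a L \<and> (u, p ^ (c - 1)) \<in> L \<and> (x, p ^ c * y) \<in> L"
proof -
  obtain j v where jv: "j \<le> c" "x - u = p ^ j * v" "j = c \<or> \<not> p dvd v"
    using prime_power_part[OF p] by blast
  then have j: "j < c" "\<not> p dvd v" using u by (auto simp: le_less)
  obtain w where w: "p ^ a dvd v * w - 1" using coprime_inverse_mod[OF p j(2)] by blast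
  define m where "m = p ^ (c - 1 - j) * (p * y - 1) * w"
  have pc: "p ^ c = p ^ (c - 1) * p" using c by (cases c) auto
  have pc': "p ^ (c - 1) = p ^ j * p ^ (c - 1 - j)" using j(1) by (simp flip: power_add)
  have "p ^ c * y - p ^ (c - 1) - m * (x - u) = p ^ (c - 1) * (p * y - 1) * (- (v * w - 1))"
    unfolding jv(2) m_def pc pc' by (simp add: algebra_simps)
  then have "p ^ a dvd p ^ c * y - p ^ (c - 1) - m * (x - u)"
    using w by (simp only: dvd_mult dvd_minus_iff)
  then have "p ^ a dvd p ^ c * y - m * x - (p ^ (c - 1) - m * u)"
    by (simp add: algebra_simps)
  then show ?thesis
    by (intro exI[of _ "{(x, y). p ^ a dvd y - m * x - (p ^ (c - 1) - m * u)}"])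
      (auto simp: zgraph_def)
qed

text \<open>Multiplying the congruence of a graph by \<open>p ^ c\<close> raises its modulus to
  \<open>p ^ (a + c)\<close>. The factor in front of \<open>y\<close> is absorbed into the new
  second coordinate, so its coefficient stays 1 and the result is again a graph.\<close>

lemma coverable_twins:
  assumes "coverable (zgraph p a) n S"
  shows "coverable (zgraph p (a + c)) n
    ((\<lambda>(x, y). (x, p ^ c * y)) ` S \<union> (\<lambda>(x, y). (x + p ^ a, p ^ c * y)) ` S)"
    (is "coverable _ _ ?T")
proof -
  obtain F where F: "finite F" "card F \<le> n" "\<forall>L\<in>F. zgraph p a L" "S \<subseteq> \<Union>F"
    using assms unfolding coverable_def by blast
  have "\<forall>L. \<exists>L'. zgraph p a L \<longrightarrow> zgraph p (a + c) L' \<and>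
    (\<forall>x y. (x, y) \<in> L \<longrightarrow> (x, p ^ c * y) \<in> L' \<and> (x + p ^ a, p ^ c * y) \<in> L')"
  proof
    fix L
    show "\<exists>L'. zgraph p a L \<longrightarrow> zgraph p (a + c) L' \<and>
      (\<forall>x y. (x, y) \<in> L \<longrightarrow> (x, p ^ c * y) \<in> L' \<and> (x + p ^ a, p ^ c * y) \<in> L')"
    proof (cases "zgraph p a L")
      case True
      then obtain m d where L: "L = {(x, y). p ^ a dvd y - m * x - d}"
        unfolding zgraph_def by blast
      have "p ^ (a + c) dvd p ^ c * y - (p ^ c * m) * x - p ^ c * d"
        if "p ^ a dvd y - m * x - d" for x y
      proof -
        have "p ^ c * p ^ a dvd p ^ c * (y - m * x - d)" using that by (rule mult_dvd_mono[OF dvd_refl])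
        then show ?thesis by (simp add: algebra_simps power_add)
      qed
      moreover have "p ^ a dvd y - m * (x + p ^ a) - d" if "p ^ a dvd y - m * x - d" for x y
      proof -
        have "p ^ a dvd (y - m * x - d) - m * p ^ a" using that by (rule dvd_diff) simp
        then show ?thesis by (simp add: algebra_simps)
      qed
      ultimately show ?thesis
        by (intro exI[of _ "{(x, y). p ^ (a + c) dvd y - (p ^ c * m) * x - p ^ c * d}"])
          (auto simp: zgraph_def L)
    qed auto
  qed
  then obtain g where g: "\<And>L. zgraph p a L \<Longrightarrow> zgraph p (a + c) (g L) \<and>
    (\<forall>x y. (x, y) \<in> L \<longrightarrow> (x, p ^ c * y) \<in> g L \<and> (x + p ^ a, p ^ c * y) \<in> g L)"
    by metis
  have "?T \<subseteq> \<Union>(g ` F)" using F(3,4) g by fastforce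
  moreover have "card (g ` F) \<le> n" using F(1,2) card_image_le le_trans by blast
  ultimately show ?thesis
    unfolding coverable_def using F g by (intro exI[of _ "g ` F"]) auto
qed

lemma critical_doubling:
  assumes p: "prime (p::int)" and c: "c \<ge> 1"
    and crit: "critical (zline p a) (zgraph p a) n S"
    and u: "\<And>x y. (x, y) \<in> S \<Longrightarrow> \<not> p ^ c dvd x - u \<and> \<not> p ^ c dvd x + p ^ a - u"
  shows "critical (zline p (a + c)) (zgraph p (a + c)) (Suc n) (doubling p a c u S)"
proof -
  let ?q = "(u, p ^ (c - 1))"
  let ?f = "\<lambda>(x, y). (x, p ^ c * y)" and ?g = "\<lambda>(x, y). (x + p ^ a, p ^ c * y)"
  have "coverable (zgraph p (a + c)) (Suc n) (doubling p a c u S - {z})"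
    if z: "z \<in> doubling p a c u S" for z
  proof -
    have ex: "\<exists>L. zgraph p (a + c) L \<and> doubling p a c u S - {z} \<subseteq> ?f ` (S - {w}) \<union> ?g ` (S - {w}) \<union> L"
      if w: "w \<in> S" and hit: "z = ?f w \<or> z = ?g w" for w
    proof -
      obtain x y where xy: "w = (x, y)" by fastforce
      \<comment> \<open>First coordinate of the twin that survives the deletion of \<open>z\<close>;
        it shares the extra line with \<open>?q\<close>.\<close>
      define x' where "x' = (if z = ?f w then x + p ^ a else x)"
      have "\<not> p ^ c dvd x' - u" using u w xy by (auto simp: x'_def)
      from zgraph_through_two_points[OF p c this] obtain L where
        "zgraph p (a + c) L" "?q \<in> L" "(x', p ^ c * y) \<in> L" by blast
      moreover have "doubling p a c u S - {z} \<subseteq> ?f ` (S - {w}) \<union> ?g ` (S - {w}) \<union> {?q, (x', p ^ c * y)}"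
        using hit unfolding doubling_def x'_def xy by (auto split: if_splits)
      ultimately show ?thesis by blast
    qed
    have "\<exists>w\<in>S. \<exists>L. zgraph p (a + c) L \<and> doubling p a c u S - {z} \<subseteq> ?f ` (S - {w}) \<union> ?g ` (S - {w}) \<union> L"
    proof (cases "z = ?q")
      case True
      \<comment> \<open>A critical set is nonempty. With \<open>?q\<close> deleted, the extra line
        can be the horizontal one through both twins of an arbitrary point.\<close>
      have "coverable (zline p a) n {}"
        unfolding coverable_def by (intro exI[of _ "{}"]) auto
      then obtain x y where w: "(x, y) \<in> S" using crit by (cases "S = {}") (auto simp: critical_def)
      have "zgraph p (a + c) {(x', y'). p ^ (a + c) dvd y' - 0 * x' - p ^ c * y}"
        unfolding zgraph_def by blast
      moreover have "doubling p a c u S - {z} \<subseteq> ?f ` (S - {(x, y)}) \<union> ?g ` (S - {(x, y)})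
          \<union> {(x', y'). p ^ (a + c) dvd y' - 0 * x' - p ^ c * y}"
        unfolding doubling_def True by auto
      ultimately show ?thesis using w by blast
    next
      case False
      then obtain w where "w \<in> S" "z = ?f w \<or> z = ?g w"
        using z unfolding doubling_def by blast
      then show ?thesis using ex by blast
    qed
    then obtain w L where w: "w \<in> S" and L: "zgraph p (a + c) L"
      and sub: "doubling p a c u S - {z} \<subseteq> ?f ` (S - {w}) \<union> ?g ` (S - {w}) \<union> L" by blast
    have "coverable (zgraph p a) n (S - {w})" using crit w by (simp add: critical_def)
    from coverable_subset[OF coverable_insert[OF coverable_twins[OF this] L] sub] show ?thesis .
  qed
  with not_coverable_doubling[OF p c] crit show ?thesis
    by (simp add: critical_def)
qed

text \<open>The added point is new because \<open>p ^ c\<close> does not divide its second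
  coordinate. The two copies of \<open>S\<close> could meet only if two points of \<open>S\<close>
  had equal height and first coordinates congruent modulo \<open>p ^ a\<close>; no graph separates
  such points, so criticality excludes them.\<close>

lemma card_doubling:
  assumes p: "prime (p::int)" and c: "c \<ge> 1" and fin: "finite S"
    and crit: "critical (zline p a) (zgraph p a) n S"
  shows "card (doubling p a c u S) = 2 * card S + 1"
proof -
  let ?q = "(u, p ^ (c - 1))"
  let ?f = "\<lambda>(x, y). (x, p ^ c * y)" and ?g = "\<lambda>(x, y). (x + p ^ a, p ^ c * y)"
  have p0: "p \<noteq> 0" using p by auto
  have nu: "\<not> is_unit p" using p not_prime_unit by blast
  have pc: "p ^ c = p ^ (c - 1) * p" using c by (cases c) auto
  have q: "?q \<notin> ?f ` S \<union> ?g ` S"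
  proof
    assume "?q \<in> ?f ` S \<union> ?g ` S"
    then obtain y where "p ^ (c - 1) * 1 = p ^ (c - 1) * (p * y)" unfolding pc by auto
    then have "1 = p * y" using p0 by (metis mult_cancel_left power_not_zero)
    then show False using nu by (metis dvd_triv_left)
  qed
  have inj: "inj_on (\<lambda>(x, y). (x mod p ^ a, y)) S"
  proof (rule critical_inj_on[OF crit])
    show "zgraph p a L \<Longrightarrow> zline p a L" for L using zgraph_imp_zline[OF nu] .
    fix L and z w :: "int \<times> int"
    assume L: "zgraph p a L" and eq: "(\<lambda>(x, y). (x mod p ^ a, y)) z = (\<lambda>(x, y). (x mod p ^ a, y)) w"
      and z: "z \<in> L"
    obtain m d where Ld: "L = {(x, y). p ^ a dvd y - m * x - d}"
      using L unfolding zgraph_def by blast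
    obtain x y x' y' where xy: "z = (x, y)" "w = (x', y')" by fastforce
    have "p ^ a dvd x - x'" "y = y'" using eq xy by (auto simp: mod_eq_dvd_iff)
    moreover have "p ^ a dvd y - m * x - d" using z xy Ld by simp
    ultimately have "p ^ a dvd (y - m * x - d) + m * (x - x')" by (intro dvd_add dvd_mult)
    then show "w \<in> L" using xy Ld \<open>y = y'\<close> by (simp add: algebra_simps)
  qed
  have disj: "?f ` S \<inter> ?g ` S = {}"
  proof (rule ccontr)
    assume "?f ` S \<inter> ?g ` S \<noteq> {}"
    then obtain x y x' y' where xy: "(x, y) \<in> S" "(x', y') \<in> S" "x = x' + p ^ a" "p ^ c * y = p ^ c * y'"
      by fastforce
    then have "y = y'" using p0 by simp
    have "(x, y) = (x', y')"
      by (rule inj_onD[OF inj _ xy(1,2)]) (simp add: xy(3) \<open>y = y'\<close>)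
    then show False using xy(3) p0 by simp
  qed
  have "inj_on ?f S" "inj_on ?g S" using p0 by (auto simp: inj_on_def)
  then have "card (?f ` S \<union> ?g ` S) = 2 * card S"
    using fin disj by (simp add: card_Un_disjoint card_image)
  then show ?thesis
    unfolding doubling_def using q fin by (subst card_insert_disjoint) auto
qed

subsection \<open>The triangular grid\<close>

text \<open>The shear makes all three directions of the triangle non-vertical, so that every line
  used to cover it is a graph.\<close>

definition triangle :: "nat \<Rightarrow> (int \<times> int) set"
  where "triangle t = (\<lambda>(j, i). (int i + 2 * int j, int j)) ` (SIGMA j:{..<t}. {..<t - j})"

lemma card_triangle: "card (triangle t) = (t + 1) choose 2"
proof -
  have "inj_on (\<lambda>(j, i). (int i + 2 * int j, int j)) (SIGMA j:{..<t}. {..<t - j})"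
    by (auto simp: inj_on_def)
  then have "card (triangle t) = (\<Sum>j<t. t - j)"
    unfolding triangle_def by (simp add: card_image)
  also have "\<dots> = (t + 1) choose 2"
  proof (induction t)
    case (Suc t)
    have "(\<Sum>j<Suc t. Suc t - j) = Suc t + (\<Sum>j<t. t - j)"
      by (subst sum.lessThan_Suc_shift) simp
    then show ?case using Suc by (simp add: numeral_2_eq_2)
  qed simp
  finally show ?thesis .
qed

text \<open>Two points of equal height force \<open>p dvd A\<close>, hence \<open>B\<close> is prime
  to \<open>p\<close>, and modulo \<open>p\<close> the whole line is horizontal.\<close>

lemma zline_two_points_horizontal:
  assumes p: "prime (p::int)" and a: "a \<ge> 1" and L: "zline p a L"
    and x: "(x, y) \<in> L" "(x', y) \<in> L" "\<not> p dvd x - x'" and z: "(x'', y'') \<in> L"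
  shows "p dvd y'' - y"
proof -
  obtain A B C where ABC: "\<not> p dvd A \<or> \<not> p dvd B"
    and L: "L = {(x, y). p ^ a dvd A * x + B * y - C}"
    using L unfolding zline_def by blast
  have dv: "p dvd A * x + B * y - C" if "(x, y) \<in> L" for x y
    using that a unfolding L by (auto intro: dvd_trans[OF dvd_power])
  have "p dvd (A * x + B * y - C) - (A * x' + B * y - C)"
    by (rule dvd_diff[OF dv[OF x(1)] dv[OF x(2)]])
  then have "p dvd A * (x - x')" by (simp add: algebra_simps)
  then have A: "p dvd A" using x(3) p by (simp add: prime_dvd_mult_iff)
  then have B: "\<not> p dvd B" using ABC by blast
  have "p dvd (A * x'' + B * y'' - C) - (A * x + B * y - C) + A * (x - x'')"
    by (rule dvd_add[OF dvd_diff[OF dv[OF z] dv[OF x(1)]] dvd_mult2[OF A]])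
  then have "p dvd B * (y'' - y)" by (simp add: algebra_simps)
  then show ?thesis using B p by (simp add: prime_dvd_mult_iff)
qed

text \<open>The bottom row has one point more than there are lines, so some line contains two of its
  points. That line is horizontal modulo \<open>p\<close>, and all heights differ by less than
  \<open>p\<close>, so it meets no higher row. Removing it and the row leaves a smaller triangle
  starting at height \<open>Suc s\<close>, which is why \<open>s\<close> varies in the
  induction.\<close>

lemma not_coverable_shifted_triangle:
  assumes p: "prime (p::int)" and a: "a \<ge> 1" and n: "int n < p"
  shows "\<not> coverable (zline p a) n {(int i + 2 * int j, int j) | i j. s \<le> j \<and> i + j \<le> s + n}"
  using n
proof (induction n arbitrary: s)
  case 0
  have "(int 0 + 2 * int s, int s) \<in> {(int i + 2 * int j, int j) | i j. s \<le> j \<and> i + j \<le> s + 0}"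
    by (intro CollectI exI[of _ 0] exI[of _ s]) auto
  then show ?case using coverable_0 by blast
next
  case (Suc n)
  let ?S = "\<lambda>s n. {(int i + 2 * int j, int j) | i j. s \<le> j \<and> i + j \<le> s + n}"
  show ?case
  proof
    assume "coverable (zline p a) (Suc n) (?S s (Suc n))"
    then obtain F where F: "finite F" "card F \<le> Suc n" "\<forall>L\<in>F. zline p a L"
      and sub: "?S s (Suc n) \<subseteq> \<Union>F"
      unfolding coverable_def by blast
    define P where "P = (\<lambda>i. (int i + 2 * int s, int s))"
    have "\<forall>i\<in>{..Suc n}. \<exists>L\<in>F. P i \<in> L"
    proof
      fix i assume "i \<in> {..Suc n}"
      then have "P i \<in> ?S s (Suc n)" unfolding P_def by auto
      then show "\<exists>L\<in>F. P i \<in> L" using sub by blast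
    qed
    then obtain g where g: "\<And>i. i \<in> {..Suc n} \<Longrightarrow> g i \<in> F \<and> P i \<in> g i" by metis
    have "card (g ` {..Suc n}) \<le> card F" using g F(1) by (intro card_mono) auto
    then have "\<not> inj_on g {..Suc n}" using F(2) by (intro pigeonhole) auto
    then obtain i i' where ii: "i \<le> Suc n" "i' \<le> Suc n" "i \<noteq> i'" "g i = g i'"
      unfolding inj_on_def by auto
    define L where "L = g i"
    have L: "L \<in> F" "P i \<in> L" "P i' \<in> L" using g[of i] g[of i'] ii unfolding L_def by auto
    have "\<not> p dvd int i - int i'"
      using zdvd_not_zless[of "\<bar>int i - int i'\<bar>" p] ii Suc.prems by auto
    then have nd: "\<not> p dvd (int i + 2 * int s) - (int i' + 2 * int s)" by simp
    have "?S (Suc s) n \<subseteq> \<Union>(F - {L})"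
    proof
      fix z assume "z \<in> ?S (Suc s) n"
      then obtain i'' j where z: "z = (int i'' + 2 * int j, int j)" "Suc s \<le> j" "i'' + j \<le> Suc s + n" by blast
      then have "z \<in> ?S s (Suc n)" by auto
      then obtain L' where L': "L' \<in> F" "z \<in> L'" using sub by blast
      have "L' \<noteq> L"
      proof
        assume "L' = L"
        then have "p dvd int j - int s"
          using zline_two_points_horizontal[OF p a _ _ _ nd, of L "int s"] F(3) L L' z
          unfolding P_def by blast
        then show False using zdvd_not_zless[of "int j - int s" p] z Suc.prems by auto
      qed
      then show "z \<in> \<Union>(F - {L})" using L' by blast
    qed
    moreover have "card (F - {L}) \<le> n" using F L by simp
    ultimately have "coverable (zline p a) n (?S (Suc s) n)"
      unfolding coverable_def using F by (intro exI[of _ "F - {L}"]) auto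
    then show False using Suc.IH[of "Suc s"] Suc.prems by simp
  qed
qed

text \<open>If the point with indices \<open>i0\<close>, \<open>j0\<close> is deleted, every other
  point has \<open>i < i0\<close>, \<open>j < j0\<close> or \<open>i + j > i0 + j0\<close>. The
  corresponding lines number at most \<open>i0 + j0 + (t - 1 - i0 - j0) = t - 1\<close>.\<close>

lemma critical_triangle:
  assumes p: "prime (p::int)" and a: "a \<ge> 1" and t: "t \<ge> 1" "int t < p" and odd: "p \<noteq> 2"
  shows "critical (zline p a) (zgraph p a) (t - 1) (triangle t)"
proof -
  have tri: "triangle t = {(int i + 2 * int j, int j) | i j. 0 \<le> j \<and> i + j \<le> 0 + (t - 1)}"
    using t unfolding triangle_def by (force simp: image_iff)
  have "\<not> coverable (zline p a) (t - 1) (triangle t)"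
    unfolding tri using t by (intro not_coverable_shifted_triangle p a) auto
  moreover have "coverable (zgraph p a) (t - 1) (triangle t - {z})" if "z \<in> triangle t" for z
  proof -
    obtain i0 j0 where z: "z = (int i0 + 2 * int j0, int j0)" "i0 + j0 < t"
      using \<open>z \<in> triangle t\<close> unfolding triangle_def by auto
    have "\<not> p dvd 2" using p odd by (metis primes_dvd_imp_eq two_is_prime_nat prime_nat_int_transfer of_nat_numeral)
    \<comment> \<open>In sheared coordinates constant \<open>i\<close> means
      \<open>x - 2 * y = i\<close>, a graph of slope 1/2; \<open>h\<close> is the inverse of 2,
      whence \<open>p\<close> must be odd.\<close>
    then obtain h where h: "p ^ a dvd 2 * h - 1" using coprime_inverse_mod[OF p] by blast
    define F1 where "F1 = (\<lambda>i. {(x, y). p ^ a dvd y - h * x - (- h * int i)}) ` {..<i0}"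
    define F2 where "F2 = (\<lambda>j. {(x, y). p ^ a dvd y - 0 * x - int j}) ` {..<j0}"
    define F3 where "F3 = (\<lambda>s. {(x, y). p ^ a dvd y - 1 * x - (- int s)}) ` {i0 + j0 + 1..<t}"
    have "card F1 \<le> i0" "card F2 \<le> j0" "card F3 \<le> t - (i0 + j0 + 1)"
      unfolding F1_def F2_def F3_def by (auto intro: card_image_le[THEN le_trans])
    then have "card (F1 \<union> F2 \<union> F3) \<le> t - 1"
      using card_Un_le[of F1 F2] card_Un_le[of "F1 \<union> F2" F3] z(2) by linarith
    moreover have "finite (F1 \<union> F2 \<union> F3)" unfolding F1_def F2_def F3_def by auto
    moreover have "\<forall>L\<in>F1 \<union> F2 \<union> F3. zgraph p a L"
      unfolding F1_def F2_def F3_def zgraph_def by blast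
    moreover have "triangle t - {z} \<subseteq> \<Union>(F1 \<union> F2 \<union> F3)"
    proof
      fix w assume w: "w \<in> triangle t - {z}"
      then obtain i j where ij: "w = (int i + 2 * int j, int j)" "i + j < t"
        unfolding triangle_def by auto
      consider "i < i0" | "j < j0" | "i0 + j0 < i + j"
        using w ij z by fastforce
      then show "w \<in> \<Union>(F1 \<union> F2 \<union> F3)"
      proof cases
        case 1
        have "int j - h * (int i + 2 * int j) - (- h * int i) = - int j * (2 * h - 1)"
          by (simp add: algebra_simps)
        then have "p ^ a dvd int j - h * (int i + 2 * int j) - (- h * int i)"
          using h by (simp only: dvd_mult)
        then have "w \<in> {(x, y). p ^ a dvd y - h * x - (- h * int i)}" using ij by simp
        then show ?thesis unfolding F1_def by (intro UnionI UnI1 imageI) (use 1 in auto)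
      next
        case 2
        then have "w \<in> {(x, y). p ^ a dvd y - 0 * x - int j}" using ij by simp
        then show ?thesis unfolding F2_def
          by (intro UnionI) (rule UnI1, rule UnI2, rule imageI, use 2 in auto)
      next
        case 3
        have "{(x, y). p ^ a dvd y - 1 * x - (- int (i + j))} \<in> F3"
          unfolding F3_def by (rule image_eqI[of _ _ "i + j"]) (use 3 ij(2) in auto)
        moreover have "w \<in> {(x, y). p ^ a dvd y - 1 * x - (- int (i + j))}" using ij by simp
        ultimately show ?thesis by blast
      qed
    qed
    ultimately show ?thesis
      unfolding coverable_def by (intro exI[of _ "F1 \<union> F2 \<union> F3"] conjI)
  qed
  ultimately show ?thesis by (simp add: critical_def)
qed

subsection \<open>Iterated doubling\<close>

text \<open>The points added by the doublings have first coordinates \<open>2 * t + p * m\<close>; those of the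
  triangle are congruent modulo p to numbers below 2 * t.\<close>

lemma iterated_doubling:
  fixes p :: nat
  assumes p: "prime p" and c: "c \<ge> 1" and a: "a \<ge> 1" and t: "t \<ge> 1" "2 * t < p"
    and M: "M \<le> p ^ (c - 1)" and n: "n \<le> M"
  shows "\<exists>S. finite S \<and> card S = 2 ^ n * ((t + 1) choose 2) + 2 ^ n - 1 \<and>
    critical (zline (int p) (a + n * c)) (zgraph (int p) (a + n * c)) (t + n - 1) S \<and>
    (\<forall>(x, y)\<in>S. (\<exists>r<2 * t. int p dvd x - int r) \<or>
      (\<exists>m<n. int p ^ c dvd x - int (2 * t + p * m)))"
  using n
proof (induction n)
  case 0
  have "critical (zline (int p) a) (zgraph (int p) a) (t - 1) (triangle t)"
    using p a t by (intro critical_triangle) auto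
  moreover have "\<exists>r<2 * t. int p dvd x - int r" if "(x, y) \<in> triangle t" for x y
  proof -
    obtain i j where "x = int i + 2 * int j" "j < t" "i < t - j"
      using \<open>(x, y) \<in> triangle t\<close> unfolding triangle_def by auto
    then show ?thesis by (intro exI[of _ "i + 2 * j"]) auto
  qed
  moreover have "finite (triangle t)" unfolding triangle_def by simp
  ultimately show ?case using card_triangle by (intro exI[of _ "triangle t"]) auto
next
  case (Suc n)
  let ?p = "int p" and ?a = "a + n * c"
  \<comment> \<open>Modulo \<open>p\<close> this is \<open>2 * t\<close>, distinct from all
    \<open>r < 2 * t\<close> since \<open>2 * t < p\<close>. It differs from earlier added
    coordinates by \<open>p * (n - m)\<close>, which \<open>p ^ c\<close> does not divide because
    \<open>0 < n - m < p ^ (c - 1)\<close>.\<close>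
  define u where "u = int (2 * t + p * n)"
  from Suc obtain S where S: "finite S" "card S = 2 ^ n * ((t + 1) choose 2) + 2 ^ n - 1"
    "critical (zline ?p ?a) (zgraph ?p ?a) (t + n - 1) S"
    and inv: "\<And>x y. (x, y) \<in> S \<Longrightarrow> (\<exists>r<2 * t. ?p dvd x - int r) \<or>
      (\<exists>m<n. ?p ^ c dvd x - int (2 * t + p * m))"
    by fastforce
  have pp: "prime ?p" using p by simp
  have pa: "?p dvd ?p ^ ?a" using a by (intro dvd_power) auto
  have pc1: "?p dvd ?p ^ c" using c by (intro dvd_power) auto
  have inv': "(\<exists>r<2 * t. ?p dvd x' - int r) \<or> (\<exists>m<n. ?p ^ c dvd x' - int (2 * t + p * m))"
    if "(x, y) \<in> S" and x': "x' = x \<or> x' = x + ?p ^ ?a" for x y x'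
    using inv[OF \<open>(x, y) \<in> S\<close>]
  proof (elim disjE exE conjE)
    fix r assume r: "r < 2 * t" "?p dvd x - int r"
    then have "?p dvd (x - int r) + ?p ^ ?a" using pa by (intro dvd_add)
    then have "?p dvd x' - int r" using x' r by (auto simp: algebra_simps)
    then show ?thesis using r by blast
  next
    fix m assume m: "m < n" "?p ^ c dvd x - int (2 * t + p * m)"
    \<comment> \<open>An earlier added point exists only if \<open>n >= 1\<close>; then the twin
      shift is a multiple of \<open>p ^ c\<close>, even when \<open>a < c\<close>.\<close>
    have "1 * c \<le> n * c" using m by (intro mult_right_mono) auto
    then have "?p ^ c dvd ?p ^ ?a" by (intro le_imp_power_dvd) linarith
    with m(2) have "?p ^ c dvd (x - int (2 * t + p * m)) + ?p ^ ?a" by (rule dvd_add)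
    then have "?p ^ c dvd x' - int (2 * t + p * m)" using x' m by (auto simp: algebra_simps)
    then show ?thesis using m by blast
  qed
  have new: "\<not> ?p ^ c dvd x' - u"
    if "(\<exists>r<2 * t. ?p dvd x' - int r) \<or> (\<exists>m<n. ?p ^ c dvd x' - int (2 * t + p * m))" for x'
  proof
    assume d: "?p ^ c dvd x' - u"
    from that show False
    proof (elim disjE exE conjE)
      fix r assume r: "r < 2 * t" "?p dvd x' - int r"
      have "?p dvd (x' - int r) - (x' - u) - ?p * int n"
        by (intro dvd_diff[OF dvd_diff[OF r(2) dvd_trans[OF pc1 d]]]) simp
      then have "?p dvd int (2 * t) - int r" by (simp add: u_def)
      then show False using zdvd_not_zless[of "int (2 * t) - int r" ?p] r t by auto
    next
      fix m assume m: "m < n" "?p ^ c dvd x' - int (2 * t + p * m)"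
      have pc: "?p ^ c = ?p * ?p ^ (c - 1)" using c by (cases c) auto
      have "?p ^ c dvd (x' - int (2 * t + p * m)) - (x' - u)" by (rule dvd_diff[OF m(2) d])
      then have "?p * ?p ^ (c - 1) dvd ?p * (int n - int m)"
        by (simp add: u_def pc algebra_simps)
      then have "?p ^ (c - 1) dvd int n - int m" using p by (auto simp: prime_gt_0_nat)
      moreover have "int n < ?p ^ (c - 1)"
        using Suc.prems M by (metis Suc_le_lessD le_trans of_nat_less_iff of_nat_power)
      ultimately show False using zdvd_not_zless[of "int n - int m" "?p ^ (c - 1)"] m(1) by linarith
    qed
  qed
  let ?S = "doubling ?p ?a c u S"
  have "critical (zline ?p (?a + c)) (zgraph ?p (?a + c)) (Suc (t + n - 1)) ?S"
    using new inv' by (intro critical_doubling pp c S) blast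
  moreover have "?a + c = a + Suc n * c" "Suc (t + n - 1) = t + Suc n - 1" using t by auto
  ultimately have "critical (zline ?p (a + Suc n * c)) (zgraph ?p (a + Suc n * c)) (t + Suc n - 1) ?S"
    by simp
  moreover have "card ?S = 2 ^ Suc n * ((t + 1) choose 2) + 2 ^ Suc n - 1"
  proof -
    \<comment> \<open>Keeps the truncated subtraction in the cardinality exact.\<close>
    have "(2::nat) ^ n \<ge> 1" by simp
    then have "Suc (2 * (2 ^ n * b + 2 ^ n - 1)) = 2 ^ Suc n * b + 2 ^ Suc n - 1" for b :: nat
      unfolding power_Suc mult.assoc by linarith
    then show ?thesis using card_doubling[OF pp c S(1,3)] S(2) by simp
  qed
  moreover have "finite ?S" using S(1) unfolding doubling_def by simp
  moreover have "(\<exists>r<2 * t. ?p dvd x - int r) \<or> (\<exists>m<Suc n. ?p ^ c dvd x - int (2 * t + p * m))"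
    if "(x, y) \<in> ?S" for x y
  proof -
    consider "x = u" | x0 y0 where "(x0, y0) \<in> S" "x = x0 \<or> x = x0 + ?p ^ ?a"
      using \<open>(x, y) \<in> ?S\<close> unfolding doubling_def by auto
    then show ?thesis
    proof cases
      case 1
      then show ?thesis unfolding u_def by auto
    next
      case 2
      then show ?thesis using inv' less_SucI by blast
    qed
  qed
  ultimately show ?case by (intro exI[of _ ?S]) auto
qed

subsection \<open>Reduction modulo the prime power\<close>

text \<open>Passes from a set of at most \<open>n\<close> lines to a list of exactly
  \<open>n\<close>, padded with \<open>L0\<close>, as \<open>covered_by_lines\<close>
  requires.\<close>

lemma finite_family_enumeration:
  assumes "finite F" "card F \<le> n" "\<forall>L\<in>F. P L" "P L0"
  obtains f where "\<forall>i<n. P (f i)" "F \<subseteq> f ` {..<n}"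
proof -
  obtain g where g: "bij_betw g {0..<card F} F"
    using ex_bij_betw_nat_finite[OF assms(1)] by blast
  define f where "f i = (if i < card F then g i else L0)" for i
  have "g i \<in> F" if "i < card F" for i using g that unfolding bij_betw_def by auto
  then have "\<forall>i<n. P (f i)" using assms(3,4) unfolding f_def by auto
  moreover have "F \<subseteq> f ` {..<n}"
  proof
    fix L assume "L \<in> F"
    then obtain i where "i < card F" "L = g i"
      using g unfolding bij_betw_def by (metis atLeastLessThan_iff imageE)
    then show "L \<in> f ` {..<n}" using assms(2) unfolding f_def by (intro image_eqI[of _ _ i]) auto
  qed
  ultimately show ?thesis using that by blast
qed

lemma residue_simps:
  "carrier (residue_ring K) = {0..K - 1}"
  "x \<oplus>\<^bsub>residue_ring K\<^esub> y = (x + y) mod K"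
  "x \<otimes>\<^bsub>residue_ring K\<^esub> y = (x * y) mod K"
  by (simp_all add: residue_ring_def)

definition reduce :: "int \<Rightarrow> int \<times> int \<Rightarrow> int \<times> int"
  where "reduce K z = (fst z mod K, snd z mod K)"

text \<open>The graph \<open>y = m * x + d\<close> is the line through \<open>(0, d)\<close> with
  direction \<open>(1, m)\<close>, and \<open>x\<close> itself is the parameter.\<close>

lemma zgraph_reduce:
  assumes K: "p ^ k > 1" and L: "zgraph p k L"
  obtains L' where "is_line (residue_ring (p ^ k)) L'" "reduce (p ^ k) ` L \<subseteq> L'"
proof -
  let ?K = "p ^ k" and ?R = "residue_ring (p ^ k)"
  interpret residues ?K ?R using K by unfold_locales auto
  obtain m d where L: "L = {(x, y). ?K dvd y - m * x - d}"
    using L unfolding zgraph_def by blast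
  let ?L = "line ?R (1, m mod ?K) (0, d mod ?K)"
  have "1 \<in> Units ?R" using Units_one_closed one_cong K by (simp add: res_one_eq)
  then have "is_line ?R ?L"
    unfolding is_line_def plane_def using K
    by (intro bexI[of _ "(0, d mod ?K)"] bexI[of _ "(1, m mod ?K)"]) (auto simp: residue_simps)
  moreover have "reduce ?K ` L \<subseteq> ?L"
  proof
    fix w assume "w \<in> reduce ?K ` L"
    then obtain x y where xy: "w = (x mod ?K, y mod ?K)" "?K dvd y - m * x - d"
      unfolding L reduce_def by auto
    have "y mod ?K = (d + x * m) mod ?K"
      using xy(2) by (simp add: mod_eq_dvd_iff algebra_simps)
    then have "w = (0 \<oplus>\<^bsub>?R\<^esub> (x mod ?K) \<otimes>\<^bsub>?R\<^esub> 1, (d mod ?K) \<oplus>\<^bsub>?R\<^esub> (x mod ?K) \<otimes>\<^bsub>?R\<^esub> (m mod ?K))"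
      using xy(1) by (simp add: residue_simps mod_simps)
    moreover have "x mod ?K \<in> carrier ?R" using K by (simp add: residue_simps)
    ultimately show "w \<in> ?L" unfolding line_def by auto
  qed
  ultimately show ?thesis using that by blast
qed

text \<open>Eliminating the parameter from \<open>x = a1 + s * b1\<close> and
  \<open>y = a2 + s * b2\<close> gives \<open>b2 * (x - a1) = b1 * (y - a2)\<close>; a unit
  coordinate of the direction is prime to \<open>p\<close>.\<close>

lemma is_line_pullback:
  assumes p: "prime p" and k: "k \<ge> 1" and L: "is_line (residue_ring (p ^ k)) L"
  shows "\<exists>L'. zline p k L' \<and> reduce (p ^ k) -` L \<subseteq> L'"
proof -
  let ?K = "p ^ k" and ?R = "residue_ring (p ^ k)"
  have K: "?K > 1" using p k by (simp add: prime_gt_1_int)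
  interpret residues ?K ?R using K by unfold_locales auto
  obtain a1 a2 b1 b2 where b: "b1 \<in> Units ?R \<or> b2 \<in> Units ?R" and Lab: "L = line ?R (b1, b2) (a1, a2)"
    using L unfolding is_line_def by (metis prod.collapse)
  have nd: "\<not> p dvd v" if "v \<in> Units ?R" for v
  proof -
    have "coprime v ?K" using that by (simp add: res_units_eq)
    then show ?thesis using p k by (metis coprime_absorb_right coprime_power_right_iff not_prime_unit not_one_le_zero)
  qed
  let ?L = "{(x, y). ?K dvd b2 * x + (- b1) * y - (b2 * a1 - b1 * a2)}"
  have "zline p k ?L" unfolding zline_def using b nd by (metis dvd_minus_iff)
  moreover have "reduce ?K -` L \<subseteq> ?L"
  proof
    fix w assume w: "w \<in> reduce ?K -` L"
    obtain x y where xy: "w = (x, y)" by fastforce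
    obtain s where "x mod ?K = a1 \<oplus>\<^bsub>?R\<^esub> s \<otimes>\<^bsub>?R\<^esub> b1" "y mod ?K = a2 \<oplus>\<^bsub>?R\<^esub> s \<otimes>\<^bsub>?R\<^esub> b2"
      using w unfolding xy Lab line_def reduce_def by auto
    then have "x mod ?K = (a1 + s * b1) mod ?K" "y mod ?K = (a2 + s * b2) mod ?K"
      by (simp_all add: residue_simps mod_simps)
    then have "?K dvd x - (a1 + s * b1)" "?K dvd y - (a2 + s * b2)"
      by (simp_all only: mod_eq_dvd_iff)
    then have "?K dvd b2 * (x - (a1 + s * b1)) - b1 * (y - (a2 + s * b2))"
      by (rule dvd_diff[OF dvd_mult dvd_mult])
    then show "w \<in> ?L" by (simp add: xy algebra_simps)
  qed
  ultimately show ?thesis by blast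
qed

lemma covered_by_lines_reduce:
  assumes K: "p ^ k > 1" and cov: "coverable (zgraph p k) n S"
  shows "covered_by_lines (residue_ring (p ^ k)) n (reduce (p ^ k) ` S)"
proof -
  let ?R = "residue_ring (p ^ k)"
  obtain F where F: "finite F" "card F \<le> n" "\<forall>L\<in>F. zgraph p k L" "S \<subseteq> \<Union>F"
    using cov unfolding coverable_def by blast
  have "zgraph p k {(x, y). p ^ k dvd y - 0 * x - 0}" unfolding zgraph_def by blast
  with F obtain f where f: "\<forall>i<n. zgraph p k (f i)" "F \<subseteq> f ` {..<n}"
    using finite_family_enumeration by metis
  have "\<forall>i. \<exists>L. i < n \<longrightarrow> is_line ?R L \<and> reduce (p ^ k) ` f i \<subseteq> L"
    using f(1) zgraph_reduce[OF K] by metis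
  then obtain g where g: "\<And>i. i < n \<Longrightarrow> is_line ?R (g i) \<and> reduce (p ^ k) ` f i \<subseteq> g i" by metis
  have "reduce (p ^ k) ` S \<subseteq> (\<Union>i<n. g i)"
  proof (rule image_subsetI)
    fix z assume "z \<in> S"
    then obtain i where "i < n" "z \<in> f i" using F(4) f(2) by blast
    then show "reduce (p ^ k) z \<in> (\<Union>i<n. g i)" using g by blast
  qed
  then show ?thesis unfolding covered_by_lines_def using g by blast
qed

text \<open>Used in contrapositive form: it carries non-coverability from integer points to the
  residue ring.\<close>

lemma coverable_pullback:
  assumes p: "prime p" and k: "k \<ge> 1"
    and cov: "covered_by_lines (residue_ring (p ^ k)) n (reduce (p ^ k) ` S)"
  shows "coverable (zline p k) n S"
proof -
  obtain L where L: "\<forall>i<n. is_line (residue_ring (p ^ k)) (L i)" "reduce (p ^ k) ` S \<subseteq> (\<Union>i<n. L i)"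
    using cov unfolding covered_by_lines_def by (elim exE conjE)
  have "\<forall>i. \<exists>L'. i < n \<longrightarrow> zline p k L' \<and> reduce (p ^ k) -` L i \<subseteq> L'"
    using L(1) is_line_pullback[OF p k] by blast
  then obtain g where g: "\<And>i. i < n \<Longrightarrow> zline p k (g i) \<and> reduce (p ^ k) -` L i \<subseteq> g i"
    by metis
  have "card (g ` {..<n}) \<le> n" using card_image_le[of "{..<n}" g] by simp
  moreover have "S \<subseteq> \<Union>(g ` {..<n})"
  proof
    fix z assume "z \<in> S"
    then obtain i where "i < n" "reduce (p ^ k) z \<in> L i" using L(2) by blast
    then show "z \<in> \<Union>(g ` {..<n})" using g by blast
  qed
  ultimately show ?thesis unfolding coverable_def using g by (intro exI[of _ "g ` {..<n}"]) auto
qed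

text \<open>Graphs cannot separate points congruent modulo \<open>p ^ k\<close>, so a critical set
  has at most one point in each class and keeps its size under reduction.\<close>

lemma critical_reduce_inj_on:
  assumes p: "prime p" and crit: "critical (zline p k) (zgraph p k) n S"
  shows "inj_on (reduce (p ^ k)) S"
proof (rule critical_inj_on[OF crit])
  show "zgraph p k L \<Longrightarrow> zline p k L" for L
    using zgraph_imp_zline p not_prime_unit by blast
  fix L and z w :: "int \<times> int"
  assume L: "zgraph p k L" and eq: "reduce (p ^ k) z = reduce (p ^ k) w" and z: "z \<in> L"
  obtain m d where Ld: "L = {(x, y). p ^ k dvd y - m * x - d}"
    using L unfolding zgraph_def by blast
  obtain x y x' y' where xy: "z = (x, y)" "w = (x', y')" by fastforce
  have "p ^ k dvd y - m * x - d" "p ^ k dvd x - x'" "p ^ k dvd y - y'"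
    using z eq xy Ld by (auto simp: reduce_def mod_eq_dvd_iff)
  then have "p ^ k dvd (y - m * x - d) + m * (x - x') - (y - y')"
    by (rule dvd_diff[OF dvd_add[OF _ dvd_mult]])
  then show "w \<in> L" using xy Ld by (simp add: algebra_simps)
qed

section \<open>The choice of parameters and the passage to the residue ring\<close>

lemma less_power_log_floor:
  assumes "p > 1" "k \<ge> 1"
  shows "k < p ^ nat (\<lfloor>log (real p) (real k)\<rfloor> + 1)"
proof -
  define N where "N = nat (\<lfloor>log (real p) (real k)\<rfloor> + 1)"
  have "log (real p) (real k) \<ge> 0" using assms by simp
  then have "log (real p) (real k) < real N" unfolding N_def by linarith
  then have "real k < real p powr real N"
    using assms by (simp add: log_less_iff)
  then have "real k < real (p ^ N)"
    using assms by (simp add: powr_realpow)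
  then show ?thesis unfolding N_def by (simp only: of_nat_less_iff)
qed

theorem theorem24:
  fixes p k t l M t' :: nat
  assumes "prime p"
    and "2 \<le> k"
    and "2 \<le> t" and "real t < sqrt (real p) / 4"
    and "l = (if k = 2 then 1 else nat (\<lfloor>log (real p) (real k)\<rfloor> + 2))"
    and "M = (if k = 2 then 1 else (k - 1) div l)"
    and "t' = t + M - 1"
  defines "R \<equiv> residue_ring (int (p ^ k))"
  shows "\<exists>S \<subseteq> plane R.
    card S = 2 ^ M * ((t + 1) choose 2) + 2 ^ M - 1
    \<and> \<not> covered_by_lines R t' S
    \<and> (\<forall>x \<in> S. covered_by_lines R t' (S - {x}))"
proof -
  have p1: "p > 1" using assms(1) prime_gt_1_nat by blast
  \<comment> \<open>The bound on \<open>t\<close> enters as \<open>2 * t < p\<close>, which keeps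
    the residue \<open>2 * t\<close> apart from those of the triangle.\<close>
  have "(4 * real t)\<^sup>2 < (sqrt (real p))\<^sup>2" using assms(4) by (intro power_strict_mono) auto
  then have "real (16 * t * t) < real p" by (simp add: power2_eq_square)
  then have "16 * t * t < p" by (simp only: of_nat_less_iff)
  moreover have "2 * t \<le> 16 * t * t" by simp
  ultimately have t2: "2 * t < p" by linarith
  \<comment> \<open>\<open>M * l < k\<close> leaves a positive exponent for the initial triangle,
    and \<open>M <= p ^ (l - 1)\<close> makes room for \<open>M\<close> added points with distinct
    first coordinates modulo \<open>p ^ l\<close>. For \<open>k > 2\<close> the latter follows from
    \<open>M <= k < p ^ (l - 1)\<close>, the logarithm bound.\<close>
  have lM: "l \<ge> 1 \<and> M * l < k \<and> M \<le> p ^ (l - 1)"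
  proof (cases "k = 2")
    case True
    then show ?thesis using assms(5,6) by simp
  next
    case False
    define f where "f = \<lfloor>log (real p) (real k)\<rfloor>"
    have "log (real p) (real k) \<ge> 0" using p1 assms(2) by simp
    then have "f \<ge> 0" unfolding f_def by simp
    moreover have "l = nat (f + 2)" using assms(5) False unfolding f_def by simp
    ultimately have l: "l \<ge> 1" "l - 1 = nat (f + 1)" by auto
    have M: "M = (k - 1) div l" using assms(6) False by simp
    have "M * l \<le> k - 1" unfolding M by simp
    moreover have "M \<le> k" unfolding M using div_le_dividend le_trans diff_le_self by blast
    moreover have "k < p ^ (l - 1)" unfolding l(2) f_def using less_power_log_floor p1 assms(2) by simp
    ultimately show ?thesis using l assms(2) by simp
  qed
  \<comment> \<open>the modulus of the initial triangle, chosen so that M doublings end at \<open>p ^ k\<close>\<close>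
  define a where "a = k - M * l"
  have a: "a \<ge> 1" "a + M * l = k" using lM unfolding a_def by auto
  let ?p = "int p"
  have "\<exists>S. finite S \<and> card S = 2 ^ M * ((t + 1) choose 2) + 2 ^ M - 1 \<and>
    critical (zline ?p (a + M * l)) (zgraph ?p (a + M * l)) (t + M - 1) S \<and>
    (\<forall>(x, y)\<in>S. (\<exists>r<2 * t. ?p dvd x - int r) \<or>
      (\<exists>m<M. ?p ^ l dvd x - int (2 * t + p * m)))"
    using assms(1,3) lM a t2 by (intro iterated_doubling) auto
  then obtain S where card: "card S = 2 ^ M * ((t + 1) choose 2) + 2 ^ M - 1"
    and crit: "critical (zline ?p k) (zgraph ?p k) t' S"
    unfolding a(2) assms(7) by blast
  have pp: "prime ?p" using assms(1) by simp
  have R: "R = residue_ring (?p ^ k)" unfolding R_def by simp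
  have K: "?p ^ k > 1" using p1 assms(2) by simp
  have inj: "inj_on (reduce (?p ^ k)) S" using critical_reduce_inj_on[OF pp crit] .
  let ?S = "reduce (?p ^ k) ` S"
  have "z mod ?p ^ k \<in> {0..?p ^ k - 1}" for z
  proof -
    have "0 < ?p ^ k" using K by linarith
    from pos_mod_bound[OF this, of z] pos_mod_sign[OF this, of z] show ?thesis
      unfolding atLeastAtMost_iff by linarith
  qed
  then have "?S \<subseteq> plane R" unfolding R plane_def residue_simps reduce_def by blast
  moreover have "card ?S = 2 ^ M * ((t + 1) choose 2) + 2 ^ M - 1"
    using card card_image[OF inj] by simp
  moreover have "\<not> covered_by_lines R t' ?S"
    using coverable_pullback[OF pp, of k t' S] crit assms(2) by (auto simp: R critical_def)
  moreover have "covered_by_lines R t' (?S - {x})" if x: "x \<in> ?S" for x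
  proof -
    obtain z where z: "z \<in> S" "x = reduce (?p ^ k) z" using x by blast
    \<comment> \<open>Injectivity lets deletion commute with reduction.\<close>
    then have "?S - {x} = reduce (?p ^ k) ` (S - {z})"
      using inj_on_image_set_diff[OF inj, of S "{z}"] by simp
    then show ?thesis
      using covered_by_lines_reduce[OF K] crit z(1) by (simp add: R critical_def)
  qed
  ultimately show ?thesis by blast
qed

end
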